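(* Let $S$ be a symmetry group in dimension $d$, let $G$ be a graph, and let $(G,p)$ be a framework in $\mathscr{R}_{(G,S)}$ with $\mathrm{Aut}(G,p)=\{id\}$. Then the unique map $\Phi:S\to\mathrm{Aut}(G)$ for which $(G,p)\in\mathscr{R}_{(G,S,\Phi)}$ is a group homomorphism.
   Context: Graphs are finite, simple, with nonempty vertex set. $\mathrm{Aut}(G)$ is the group (under composition) of automorphisms of $G$; $id$ is its identity. A framework in $\mathbb{R}^d$ (also called a $d$-dimensional realization of $G$) is a pair $(G,p)$ with $G$ a graph and $p:V(G)\to\mathbb{R}^d$ a map with $p(u)\neq p(v)$ whenever $\{u,v\}\in E(G)$; $p$ need not be injective. A symmetry operation of $(G,p)$ is an isometry $x$ of $\mathbb{R}^d$ such that for some $\alpha\in\mathrm{Aut}(G)$, $x(p(v))=p(\alpha(v))$ for all $v\in V(G)$. The point group of $(G,p)$ is the group of all its symmetry operations. A symmetry group in dimension $d$ is a subgroup of the orthogonal group $O(\mathbb{R}^d)$. $\mathscr{R}_{(G,S)}$ is the set of all $d$-dimensional realizations of $G$ whose point group equals $S$ or contains $S$ as a subgroup. For a map $\Phi:S\to\mathrm{Aut}(G)$ (not necessarily a homomorphism), $\mathscr{R}_{(G,S,\Phi)}$ is the set of all $(G,p)\in\mathscr{R}_{(G,S)}$ with $x(p(v))=p(\Phi(x)(v))$ for all $v\in V(G)$ and all $x\in S$. $\mathrm{Aut}(G,p)$ denotes the set (a subgroup of $\mathrm{Aut}(G)$) of all $\alpha\in\mathrm{Aut}(G)$ with $p(v)=p(\alpha(v))$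 for all $v\in V(G)$. *)

theory Defs
  imports "HOL-Analysis.Analysis" "HOL-Algebra.Bij" "Graph_Theory.Pair_Digraph"
begin

text \<open>
  A finite simple graph is a \<^locale>\<open>pair_graph\<close>: each edge \<open>{u, v}\<close> is represented by the two
  arcs \<open>(u, v)\<close> and \<open>(v, u)\<close>. The library allows an empty vertex set, so \<open>pverts G \<noteq> {}\<close> has to
  be assumed separately.

  All groups below consist of bijections under composition and carry the structure of
  \<^const>\<open>BijGroup\<close>. Its elements are extensional: a permutation of \<open>pverts G\<close> takes the value
  \<^const>\<open>undefined\<close> at all other points, so that equality of automorphisms is equality on the
  vertices. For bijections of the whole space this is no restriction.
\<close>

definition graph_automorphisms :: "'v pair_pre_digraph \<Rightarrow> ('v \<Rightarrow> 'v) set" where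
  "graph_automorphisms G =
     {\<alpha> \<in> Bij (pverts G). \<forall>u\<in>pverts G. \<forall>v\<in>pverts G.
        (u, v) \<in> parcs G \<longleftrightarrow> (\<alpha> u, \<alpha> v) \<in> parcs G}"

definition Aut_graph :: "'v pair_pre_digraph \<Rightarrow> ('v \<Rightarrow> 'v) monoid" where
  "Aut_graph G = BijGroup (pverts G) \<lparr>carrier := graph_automorphisms G\<rparr>"

definition isometry :: "('a::metric_space \<Rightarrow> 'a) \<Rightarrow> bool" where
  "isometry x \<longleftrightarrow> (\<forall>a b. dist (x a) (x b) = dist a b)"

definition orthogonal_group :: "(real^'d \<Rightarrow> real^'d) monoid" where
  "orthogonal_group = BijGroup UNIV \<lparr>carrier := {x. orthogonal_transformation x}\<rparr>"

text \<open>Only the values of \<open>p\<close> on \<open>pverts G\<close> are relevant.\<close>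

definition framework :: "'v pair_pre_digraph \<Rightarrow> ('v \<Rightarrow> real^'d) \<Rightarrow> bool" where
  "framework G p \<longleftrightarrow> (\<forall>(u, v)\<in>parcs G. p u \<noteq> p v)"

definition symmetry_operation ::
    "'v pair_pre_digraph \<Rightarrow> ('v \<Rightarrow> real^'d) \<Rightarrow> (real^'d \<Rightarrow> real^'d) \<Rightarrow> bool" where
  "symmetry_operation G p x \<longleftrightarrow>
     isometry x \<and> (\<exists>\<alpha>\<in>carrier (Aut_graph G). \<forall>v\<in>pverts G. x (p v) = p (\<alpha> v))"

definition point_group ::
    "'v pair_pre_digraph \<Rightarrow> ('v \<Rightarrow> real^'d) \<Rightarrow> (real^'d \<Rightarrow> real^'d) monoid" where
  "point_group G p = BijGroup UNIV \<lparr>carrier := {x. symmetry_operation G p x}\<rparr>"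

definition realizations ::
    "'v pair_pre_digraph \<Rightarrow> (real^'d \<Rightarrow> real^'d) set
      \<Rightarrow> ('v pair_pre_digraph \<times> ('v \<Rightarrow> real^'d)) set" where
  "realizations G S =
     {(G, p) | p. framework G p \<and>
        (carrier (point_group G p) = S \<or> subgroup S (point_group G p))}"

definition realizations_of_type ::
    "'v pair_pre_digraph \<Rightarrow> (real^'d \<Rightarrow> real^'d) set \<Rightarrow> ((real^'d \<Rightarrow> real^'d) \<Rightarrow> ('v \<Rightarrow> 'v))
      \<Rightarrow> ('v pair_pre_digraph \<times> ('v \<Rightarrow> real^'d)) set" where
  "realizations_of_type G S \<Phi> =
     {(G, p) | p. (G, p) \<in> realizations G S \<and>
        (\<forall>x\<in>S. \<forall>v\<in>pverts G. x (p v) = p (\<Phi> x v))}"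

definition Aut_framework :: "'v pair_pre_digraph \<Rightarrow> ('v \<Rightarrow> real^'d) \<Rightarrow> ('v \<Rightarrow> 'v) set" where
  "Aut_framework G p =
     {\<alpha> \<in> carrier (Aut_graph G). \<forall>v\<in>pverts G. p v = p (\<alpha> v)}"

lemma subgroup_graph_automorphisms:
  "subgroup (graph_automorphisms G) (BijGroup (pverts G))"
proof (rule group.subgroupI[OF group_BijGroup])
  show "graph_automorphisms G \<subseteq> carrier (BijGroup (pverts G))"
    by (auto simp: graph_automorphisms_def BijGroup_def)
  have "(\<lambda>v\<in>pverts G. v) \<in> graph_automorphisms G"
    by (simp add: graph_automorphisms_def id_Bij)
  then show "graph_automorphisms G \<noteq> {}" by blast
next
  fix \<alpha> assume a: "\<alpha> \<in> graph_automorphisms G"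
  then have B: "\<alpha> \<in> Bij (pverts G)"
    and e: "\<And>u v. u \<in> pverts G \<Longrightarrow> v \<in> pverts G \<Longrightarrow> (u, v) \<in> parcs G \<longleftrightarrow> (\<alpha> u, \<alpha> v) \<in> parcs G"
    by (auto simp: graph_automorphisms_def)
  from B have im: "\<alpha> ` pverts G = pverts G" by (simp add: Bij_def bij_betw_def)
  have "(inv_into (pverts G) \<alpha> u, inv_into (pverts G) \<alpha> v) \<in> parcs G \<longleftrightarrow> (u, v) \<in> parcs G"
    if "u \<in> pverts G" "v \<in> pverts G" for u v
    using e[of "inv_into (pverts G) \<alpha> u" "inv_into (pverts G) \<alpha> v"] that im
    by (simp add: f_inv_into_f inv_into_into)
  then show "inv\<^bsub>BijGroup (pverts G)\<^esub> \<alpha> \<in> graph_automorphisms G"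
    using B by (simp add: inv_BijGroup graph_automorphisms_def restrict_inv_into_Bij)
next
  fix \<alpha> \<beta> assume ab: "\<alpha> \<in> graph_automorphisms G" "\<beta> \<in> graph_automorphisms G"
  then have B: "\<alpha> \<in> Bij (pverts G)" "\<beta> \<in> Bij (pverts G)"
    by (auto simp: graph_automorphisms_def)
  with ab show "\<alpha> \<otimes>\<^bsub>BijGroup (pverts G)\<^esub> \<beta> \<in> graph_automorphisms G"
    using Bij_imp_funcset[OF B(2)]
    by (auto simp: BijGroup_def graph_automorphisms_def compose_Bij compose_eq Pi_iff)
qed

lemma group_Aut_graph: "group (Aut_graph G)"
  unfolding Aut_graph_def
  by (rule subgroup.subgroup_is_group[OF subgroup_graph_automorphisms group_BijGroup])

lemma Bij_UNIV: "Bij UNIV = {f. bij f}"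
  by (auto simp: Bij_def extensional_def)

lemma isometry_bij:
  fixes x :: "real^'d \<Rightarrow> real^'d"
  assumes "isometry x"
  shows "bij x"
proof -
  have "orthogonal_transformation (\<lambda>a. x a - x 0)"
    using assms by (simp add: orthogonal_transformation_isometry isometry_def dist_norm)
  then have "bij (\<lambda>a. x a - x 0)" by (rule orthogonal_transformation_bij)
  then have "bij ((\<lambda>b. b + x 0) \<circ> (\<lambda>a. x a - x 0))"
    by (rule bij_comp) (rule bij_plus_right)
  then show ?thesis by (simp add: comp_def)
qed

lemma group_orthogonal_group: "group (orthogonal_group :: (real^'d \<Rightarrow> real^'d) monoid)"
  unfolding orthogonal_group_def
proof (rule subgroup.subgroup_is_group[OF group.subgroupI[OF group_BijGroup] group_BijGroup])
  show "{x :: real^'d \<Rightarrow> real^'d. orthogonal_transformation x} \<subseteq> carrier (BijGroup UNIV)"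
    by (auto simp: BijGroup_def Bij_UNIV orthogonal_transformation_bij)
  show "{x :: real^'d \<Rightarrow> real^'d. orthogonal_transformation x} \<noteq> {}"
    using orthogonal_transformation_id by blast
next
  fix x :: "real^'d \<Rightarrow> real^'d"
  assume x: "x \<in> {x. orthogonal_transformation x}"
  then show "inv\<^bsub>BijGroup UNIV\<^esub> x \<in> {x. orthogonal_transformation x}"
    by (simp add: inv_BijGroup Bij_UNIV restrict_UNIV orthogonal_transformation_bij orthogonal_transformation_inv)
next
  fix x y :: "real^'d \<Rightarrow> real^'d"
  assume "x \<in> {x. orthogonal_transformation x}" "y \<in> {x. orthogonal_transformation x}"
  moreover from this have "orthogonal_transformation (x \<circ> y)"
    by (simp add: orthogonal_transformation_compose)
  ultimately show "x \<otimes>\<^bsub>BijGroup UNIV\<^esub> y \<in> {x. orthogonal_transformation x}"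
    by (simp add: BijGroup_def Bij_UNIV orthogonal_transformation_bij compose_def comp_def restrict_UNIV)
qed

lemma group_point_group: "group (point_group G (p :: 'v \<Rightarrow> real^'d))"
  unfolding point_group_def
proof (rule subgroup.subgroup_is_group[OF group.subgroupI[OF group_BijGroup] group_BijGroup])
  interpret A: group "Aut_graph G" by (rule group_Aut_graph)
  have in_V: "\<alpha> v \<in> pverts G" if "\<alpha> \<in> carrier (Aut_graph G)" "v \<in> pverts G" for \<alpha> v
    using that by (auto simp: Aut_graph_def graph_automorphisms_def dest!: Bij_imp_funcset)
  have mult: "(\<alpha> \<otimes>\<^bsub>Aut_graph G\<^esub> \<beta>) v = \<alpha> (\<beta> v)"
    if "\<alpha> \<in> carrier (Aut_graph G)" "\<beta> \<in> carrier (Aut_graph G)" "v \<in> pverts G" for \<alpha> \<beta> v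
    using that by (simp add: Aut_graph_def graph_automorphisms_def BijGroup_def compose_eq)
  have one: "\<one>\<^bsub>Aut_graph G\<^esub> v = v" if "v \<in> pverts G" for v
    using that by (simp add: Aut_graph_def BijGroup_def)
  have bij: "bij x" if "symmetry_operation G p x" for x
    using that isometry_bij by (auto simp: symmetry_operation_def)
  show "{x. symmetry_operation G p x} \<subseteq> carrier (BijGroup UNIV)"
    using bij by (auto simp: BijGroup_def Bij_UNIV)
  have "symmetry_operation G p id"
    unfolding symmetry_operation_def isometry_def
    by (intro conjI bexI[of _ "\<one>\<^bsub>Aut_graph G\<^esub>"]) (auto simp: one)
  then show "{x. symmetry_operation G p x} \<noteq> {}" by blast
  show "inv\<^bsub>BijGroup UNIV\<^esub> x \<in> {x. symmetry_operation G p x}"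
    if "x \<in> {x. symmetry_operation G p x}" for x
  proof -
    from that obtain \<alpha> where x: "isometry x" and a: "\<alpha> \<in> carrier (Aut_graph G)"
      and xa: "\<And>v. v \<in> pverts G \<Longrightarrow> x (p v) = p (\<alpha> v)"
      by (auto simp: symmetry_operation_def)
    from x have b: "bij x" by (rule isometry_bij)
    have "isometry (inv_into UNIV x)"
      using x b unfolding isometry_def by (metis bij_inv_eq_iff)
    moreover have "inv_into UNIV x (p v) = p ((inv\<^bsub>Aut_graph G\<^esub> \<alpha>) v)" if v: "v \<in> pverts G" for v
    proof -
      let ?w = "(inv\<^bsub>Aut_graph G\<^esub> \<alpha>) v"
      have "\<alpha> ?w = v"
        using mult[OF a A.inv_closed[OF a] v] A.r_inv[OF a] one[OF v] by simp
      then have "x (p ?w) = p v" using xa[OF in_V[OF A.inv_closed[OF a] v]] by simp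
      then show ?thesis using b by (metis bij_inv_eq_iff)
    qed
    ultimately have "symmetry_operation G p (inv_into UNIV x)"
      unfolding symmetry_operation_def using A.inv_closed[OF a] by blast
    then show ?thesis using b by (simp add: inv_BijGroup Bij_UNIV restrict_UNIV)
  qed
  show "x \<otimes>\<^bsub>BijGroup UNIV\<^esub> y \<in> {x. symmetry_operation G p x}"
    if "x \<in> {x. symmetry_operation G p x}" "y \<in> {x. symmetry_operation G p x}" for x y
  proof -
    from that obtain \<alpha> \<beta> where xy: "isometry x" "isometry y"
      and ab: "\<alpha> \<in> carrier (Aut_graph G)" "\<beta> \<in> carrier (Aut_graph G)"
      and "\<And>v. v \<in> pverts G \<Longrightarrow> x (p v) = p (\<alpha> v)" "\<And>v. v \<in> pverts G \<Longrightarrow> y (p v) = p (\<beta> v)"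
      by (auto simp: symmetry_operation_def)
    then have "\<forall>v\<in>pverts G. (x \<circ> y) (p v) = p ((\<alpha> \<otimes>\<^bsub>Aut_graph G\<^esub> \<beta>) v)"
      using in_V mult by simp
    then have "symmetry_operation G p (x \<circ> y)"
      unfolding symmetry_operation_def using xy A.m_closed[OF ab]
      by (auto simp: isometry_def)
    then show ?thesis using that bij by (simp add: BijGroup_def Bij_UNIV compose_def comp_def restrict_UNIV)
  qed
qed

end

theory Submission
  imports Defs
begin

text \<open>Trivial Aut(G,p) means that an automorphism \<alpha> is determined by the placement v
  |-> p (\<alpha> v): if \<alpha> and \<beta> give the same placement, then \<alpha> composed with
  the inverse of \<beta> preserves p and is the identity (\<open>Aut_graph_eqI\<close>). Every x in
  S is a symmetry operation (\<open>realizations_symmetry_operation\<close>), hence is induced by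
  some automorphism, and now by exactly one; this gives existence and uniqueness of \<Phi>. It also
  gives multiplicativity, since \<Phi>(x o y) and \<Phi>(x) \<Phi>(y) both induce x o y on the
  points of the framework.\<close>

lemma Aut_graph_mem:
  assumes "\<alpha> \<in> carrier (Aut_graph G)" "v \<in> pverts G"
  shows "\<alpha> v \<in> pverts G"
  using assms by (auto simp: Aut_graph_def graph_automorphisms_def dest!: Bij_imp_funcset)

lemma Aut_graph_mult_apply:
  assumes "\<alpha> \<in> carrier (Aut_graph G)" "\<beta> \<in> carrier (Aut_graph G)" "v \<in> pverts G"
  shows "(\<alpha> \<otimes>\<^bsub>Aut_graph G\<^esub> \<beta>) v = \<alpha> (\<beta> v)"
  using assms by (simp add: Aut_graph_def graph_automorphisms_def BijGroup_def compose_eq)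

lemma Aut_graph_one_apply:
  "v \<in> pverts G \<Longrightarrow> \<one>\<^bsub>Aut_graph G\<^esub> v = v"
  by (simp add: Aut_graph_def BijGroup_def)

text \<open>The product of \<open>BijGroup\<close> is restricted to bijections, so it is plain
  composition only for arguments known to be bijective; membership in the carrier supplies
  this.\<close>

lemma orthogonal_group_mult:
  assumes "x \<in> carrier orthogonal_group" "y \<in> carrier orthogonal_group"
  shows "x \<otimes>\<^bsub>orthogonal_group\<^esub> y = x \<circ> y"
  using assms
  by (simp add: orthogonal_group_def BijGroup_def Bij_UNIV orthogonal_transformation_bij
      compose_def comp_def restrict_UNIV)

lemma Aut_graph_eqI:
  assumes triv: "Aut_framework G p = {\<one>\<^bsub>Aut_graph G\<^esub>}"
    and a: "\<alpha> \<in> carrier (Aut_graph G)" and b: "\<beta> \<in> carrier (Aut_graph G)"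
    and eq: "\<And>v. v \<in> pverts G \<Longrightarrow> p (\<alpha> v) = p (\<beta> v)"
  shows "\<alpha> = \<beta>"
proof -
  interpret A: group "Aut_graph G" by (rule group_Aut_graph)
  let ?\<gamma> = "\<alpha> \<otimes>\<^bsub>Aut_graph G\<^esub> inv\<^bsub>Aut_graph G\<^esub> \<beta>"
  have "p v = p (?\<gamma> v)" if v: "v \<in> pverts G" for v
  proof -
    \<comment> \<open>Evaluating the hypothesis at the preimage of v under \<beta> turns its right
      side into p v.\<close>
    let ?w = "(inv\<^bsub>Aut_graph G\<^esub> \<beta>) v"
    have "\<beta> ?w = v"
      using Aut_graph_mult_apply[OF b A.inv_closed[OF b] v] A.r_inv[OF b] Aut_graph_one_apply[OF v]
      by simp
    then show ?thesis
      using eq[OF Aut_graph_mem[OF A.inv_closed[OF b] v]]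
        Aut_graph_mult_apply[OF a A.inv_closed[OF b] v] by simp
  qed
  then have "?\<gamma> \<in> Aut_framework G p"
    using a b by (simp add: Aut_framework_def)
  \<comment> \<open>Triviality gives \<open>?\<gamma>\<close> = 1, so \<alpha> is the inverse of the
    inverse of \<beta>.\<close>
  then show ?thesis
    using triv a b A.inv_equality[of \<alpha> "inv\<^bsub>Aut_graph G\<^esub> \<beta>"] by simp
qed

text \<open>Both alternatives in \<open>realizations\<close>, equality with the point group or being
  a subgroup of it, put S inside its carrier.\<close>

lemma realizations_symmetry_operation:
  assumes "(G, p) \<in> realizations G S" "x \<in> S"
  shows "symmetry_operation G p x"
  using assms by (auto simp: realizations_def point_group_def dest!: subgroup.subset)

theorem theorem6p1:
  fixes S :: "(real^'d \<Rightarrow> real^'d) set"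
    and G :: "'v pair_pre_digraph"
    and p :: "'v \<Rightarrow> real^'d"
  assumes "subgroup S orthogonal_group"
    and "pair_graph G" and "pverts G \<noteq> {}"
    and "(G, p) \<in> realizations G S"
    and "Aut_framework G p = {\<one>\<^bsub>Aut_graph G\<^esub>}"
  shows "(\<exists>!\<Phi>. \<Phi> \<in> S \<rightarrow>\<^sub>E carrier (Aut_graph G) \<and> (G, p) \<in> realizations_of_type G S \<Phi>) \<and>
    (\<forall>\<Phi>. \<Phi> \<in> S \<rightarrow>\<^sub>E carrier (Aut_graph G) \<and> (G, p) \<in> realizations_of_type G S \<Phi> \<longrightarrow>
      \<Phi> \<in> hom (orthogonal_group\<lparr>carrier := S\<rparr>) (Aut_graph G))"
proof -
  interpret A: group "Aut_graph G" by (rule group_Aut_graph)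
  note eqI = Aut_graph_eqI[OF assms(5)]
  have type_iff: "(G, p) \<in> realizations_of_type G S \<Phi> \<longleftrightarrow>
      (\<forall>x\<in>S. \<forall>v\<in>pverts G. x (p v) = p (\<Phi> x v))" for \<Phi>
    using assms(4) by (simp add: realizations_of_type_def)
  have "\<forall>x\<in>S. \<exists>\<alpha>. \<alpha> \<in> carrier (Aut_graph G) \<and> (\<forall>v\<in>pverts G. x (p v) = p (\<alpha> v))"
    using realizations_symmetry_operation[OF assms(4)] by (auto simp: symmetry_operation_def)
  then obtain \<Psi> where \<Psi>: "\<forall>x\<in>S. \<Psi> x \<in> carrier (Aut_graph G) \<and>
      (\<forall>v\<in>pverts G. x (p v) = p (\<Psi> x v))"
    by (rule bchoice[THEN exE])
  have unique: "\<exists>!\<Phi>. \<Phi> \<in> S \<rightarrow>\<^sub>E carrier (Aut_graph G) \<and> (G, p) \<in> realizations_of_type G S \<Phi>"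
  \<comment> \<open>Choice leaves \<open>\<Psi>\<close> arbitrary off S. Restricting it gives the
    value \<open>undefined\<close> there, as \<open>\<rightarrow>\<^sub>E\<close> demands, so that
    agreement on S implies equality of functions.\<close>
  proof (rule ex1I[of _ "restrict \<Psi> S"])
    show "restrict \<Psi> S \<in> S \<rightarrow>\<^sub>E carrier (Aut_graph G) \<and>
        (G, p) \<in> realizations_of_type G S (restrict \<Psi> S)"
      using \<Psi> by (auto simp: type_iff)
  next
    fix \<Phi>
    assume \<Phi>: "\<Phi> \<in> S \<rightarrow>\<^sub>E carrier (Aut_graph G) \<and> (G, p) \<in> realizations_of_type G S \<Phi>"
    show "\<Phi> = restrict \<Psi> S"
    proof (rule PiE_ext)
      show "\<Phi> \<in> S \<rightarrow>\<^sub>E carrier (Aut_graph G)" using \<Phi> by blast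
      show "restrict \<Psi> S \<in> S \<rightarrow>\<^sub>E carrier (Aut_graph G)" using \<Psi> by auto
      fix x assume x: "x \<in> S"
      have "\<Phi> x = \<Psi> x"
      proof (rule eqI)
        show "\<Phi> x \<in> carrier (Aut_graph G)" using \<Phi> x by auto
        show "\<Psi> x \<in> carrier (Aut_graph G)" using \<Psi> x by blast
        show "p (\<Phi> x v) = p (\<Psi> x v)" if "v \<in> pverts G" for v
          using \<Phi> \<Psi> x that unfolding type_iff by metis
      qed
      with x show "\<Phi> x = restrict \<Psi> S x" by simp
    qed
  qed
  have "\<Phi> \<in> hom (orthogonal_group\<lparr>carrier := S\<rparr>) (Aut_graph G)"
    if \<Phi>: "\<Phi> \<in> S \<rightarrow>\<^sub>E carrier (Aut_graph G)" and "(G, p) \<in> realizations_of_type G S \<Phi>" for \<Phi>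
  proof (rule homI)
    have closed: "\<Phi> x \<in> carrier (Aut_graph G)" if "x \<in> S" for x
      using \<Phi> that by auto
    have act: "x (p v) = p (\<Phi> x v)" if "x \<in> S" "v \<in> pverts G" for x v
      using \<open>(G, p) \<in> realizations_of_type G S \<Phi>\<close> that by (simp add: type_iff)
    show "\<Phi> x \<in> carrier (Aut_graph G)" if "x \<in> carrier (orthogonal_group\<lparr>carrier := S\<rparr>)" for x
      using closed that by simp
    fix x y
    assume "x \<in> carrier (orthogonal_group\<lparr>carrier := S\<rparr>)"
      and "y \<in> carrier (orthogonal_group\<lparr>carrier := S\<rparr>)"
    then have x: "x \<in> S" and y: "y \<in> S" by auto
    have xy: "x \<otimes>\<^bsub>orthogonal_group\<^esub> y = x \<circ> y"
      using x y subgroup.mem_carrier[OF assms(1)] by (simp add: orthogonal_group_mult)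
    have xyS: "x \<circ> y \<in> S"
      using subgroup.m_closed[OF assms(1) x y] xy by simp
    \<comment> \<open>By \<open>eqI\<close> it suffices to compare the two automorphisms after
      applying p.\<close>
    have "\<Phi> (x \<circ> y) = \<Phi> x \<otimes>\<^bsub>Aut_graph G\<^esub> \<Phi> y"
    proof (rule eqI)
      show "p (\<Phi> (x \<circ> y) v) = p ((\<Phi> x \<otimes>\<^bsub>Aut_graph G\<^esub> \<Phi> y) v)" if v: "v \<in> pverts G" for v
      proof -
        have "p (\<Phi> (x \<circ> y) v) = x (y (p v))"
          using act[OF xyS v] by simp
        \<comment> \<open>The point y (p v) is the position of the vertex \<open>\<Phi> y v\<close>,
          so the relation for x can be applied at that vertex.\<close>
        also have "\<dots> = p (\<Phi> x (\<Phi> y v))"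
          using act[OF y v] act[OF x Aut_graph_mem[OF closed[OF y] v]] by simp
        finally show ?thesis
          by (simp add: Aut_graph_mult_apply[OF closed[OF x] closed[OF y] v])
      qed
    qed (use closed x y xyS in auto)
    then show "\<Phi> (x \<otimes>\<^bsub>orthogonal_group\<lparr>carrier := S\<rparr>\<^esub> y) = \<Phi> x \<otimes>\<^bsub>Aut_graph G\<^esub> \<Phi> y"
      using xy by simp
  qed
  with unique show ?thesis by blast
qed

end
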